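(* Let $k,t,m_1,\dots,m_k$ be integers with $k\ge 3$ and $1\le t-1\le m_1\le m_2\le\cdots\le m_k$. Then \[ \operatorname{R}^{\sharp}_{k,t}(\mathcal{B}\,|\,B_{m_1},\dots,B_{m_k})>\min\left\{m_1+\frac{h_{m_1}(t)+(h_{m_1}(t)-1)\log_2(k-1)-1}{4\binom{m_1}{\lfloor m_1/2\rfloor}},\ m_k+\frac{h_{m_k}(t)-1}{2\binom{m_k}{\lfloor m_k/2\rfloor}}\right\}. \]
   Context: $B_n$ denotes the Boolean lattice of all subsets of $[n]=\{1,\dots,n\}$ ordered by inclusion. A $t$-chain is a set of $t$ distinct pairwise comparable elements; $h_n(t)$ is the number of $t$-chains in $B_n$. A strong embedding $f:B_m\to B_N$ is an injection with $f(x)\subseteq f(y)$ if and only if $x\subseteq y$. For a $k$-coloring of the $t$-chains of $B_N$ (each $t$-chain receives one of the colors $1,\dots,k$), a monochromatic induced copy of $B_m$ in color $i$ is a strong embedding $f:B_m\to B_N$ such that $f(A)$ has color $i$ for every $t$-chain $A$ of $B_m$. $\operatorname{R}^{\sharp}_{k,t}(\mathcal{B}\,|\,B_{m_1},\dots,B_{m_k})$ is the smallest $N$ such that every $k$-coloring of the $t$-chains of $B_N$ contains, for some $i$, a monochromatic induced copy of $B_{m_i}$ in color $i$.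
   Formalization: The case m_k = 1 (so t = 2 and all m_i = 1) is excluded: there both terms of the minimum equal 1, but B_1 has a single 2-chain, so R = 1 and the strict inequality fails. *)

theory Defs
  imports Complex_Main "HOL-Library.Extended_Real" "HOL-Library.FuncSet"
begin

definition boolean_lattice :: "nat \<Rightarrow> nat set set" where
  "boolean_lattice n = Pow {1..n}"

definition t_chains :: "nat \<Rightarrow> nat \<Rightarrow> nat set set set" where
  "t_chains t n = {A. subset.chain (boolean_lattice n) A \<and> card A = t}"

definition num_chains :: "nat \<Rightarrow> nat \<Rightarrow> nat" where
  "num_chains t n = card (t_chains t n)"

definition strong_embedding :: "nat \<Rightarrow> nat \<Rightarrow> (nat set \<Rightarrow> nat set) \<Rightarrow> bool" where
  "strong_embedding m N f \<longleftrightarrow>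
     f \<in> boolean_lattice m \<rightarrow> boolean_lattice N \<and>
     inj_on f (boolean_lattice m) \<and>
     (\<forall>x\<in>boolean_lattice m. \<forall>y\<in>boolean_lattice m. f x \<subseteq> f y \<longleftrightarrow> x \<subseteq> y)"

definition mono_induced_copy ::
  "nat \<Rightarrow> nat \<Rightarrow> (nat set set \<Rightarrow> nat) \<Rightarrow> nat \<Rightarrow> nat \<Rightarrow> (nat set \<Rightarrow> nat set) \<Rightarrow> bool" where
  "mono_induced_copy t N c i m f \<longleftrightarrow>
     strong_embedding m N f \<and> (\<forall>A\<in>t_chains t m. c (f ` A) = i)"

definition ramsey_property :: "nat \<Rightarrow> nat \<Rightarrow> (nat \<Rightarrow> nat) \<Rightarrow> nat \<Rightarrow> bool" where
  "ramsey_property k t m N \<longleftrightarrow>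
     (\<forall>c \<in> t_chains t N \<rightarrow> {1..k}. \<exists>i\<in>{1..k}. \<exists>f. mono_induced_copy t N c i (m i) f)"

(* The infimum is the least element whenever some N has the property.
   It is taken in enat so that it would be infinite, rather than an
   unspecified number, if no N had the property. *)
definition boolean_ramsey :: "nat \<Rightarrow> nat \<Rightarrow> (nat \<Rightarrow> nat) \<Rightarrow> enat" where
  "boolean_ramsey k t m = Inf (enat ` {N. ramsey_property k t m N})"

end

theory Submission
  imports Defs
begin

text \<open>
  First moment method. A strong embedding of \<open>B\<^sub>m\<close> into \<open>B\<^sub>N\<close> has, for every \<open>i \<in> [m]\<close>, a coordinate that
  copies the \<open>i\<close>-th one, and each of the other \<open>N - m\<close> coordinates is an up-set of \<open>B\<^sub>m\<close>; by Hansel's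
  theorem there are at most \<open>3 ^ b\<close> up-sets, where \<open>b\<close> is the central binomial coefficient. Hence
  \<open>B\<^sub>N\<close> contains at most \<open>(N choose m) * 3 ^ (b * (N - m))\<close> copies of \<open>B\<^sub>m\<close>. Colour the \<open>t\<close>-chains
  independently, using colour \<open>k\<close> with probability \<open>1 / 2\<close> and every other colour with probability
  \<open>1 / (2 * (k - 1))\<close>. It suffices to avoid \<open>B\<^bsub>m\<^sub>1\<^esub>\<close> in the colours below \<open>k\<close>, since it embeds into
  all the other lattices, and \<open>B\<^bsub>m\<^sub>k\<^esub>\<close> in colour \<open>k\<close>. The two terms of the minimum make the two
  contributions to the expected number of forbidden copies add up to less than one.
\<close>

subsection \<open>Symmetric chains and Hansel's bound\<close>

text \<open>
  The symmetric chain decomposition of de Bruijn, Tengbergen and Kruyswijk for the subsets of a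
  list of \<open>n\<close> distinct elements, every chain being represented by its least element: the chain
  of \<open>B\<close> occupies the ranks from \<open>card B\<close> to \<open>n - card B\<close>.
\<close>

fun chain_bottom :: "'a list \<Rightarrow> 'a set \<Rightarrow> 'a set" where
  "chain_bottom [] x = {}"
| "chain_bottom (a # l) x =
    (let B = chain_bottom l (x - {a}) in
     if a \<in> x \<and> card (x - {a}) + card B < length l then insert a B else B)"

declare chain_bottom.simps(2) [simp del]

lemma chain_bottom_subset: "chain_bottom l x \<subseteq> x"
  by (induction l arbitrary: x) (auto simp: chain_bottom.simps(2) Let_def)

text \<open>Putting \<open>a\<close> into the bottom raises the left side by two and the length by
  one only; the strict inequality in the recursion of \<open>chain_bottom\<close> supplies the
  missing unit.\<close>

lemma card_chain_bottom_le:
  assumes "distinct l" "x \<subseteq> set l"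
  shows "card x + card (chain_bottom l x) \<le> length l"
  using assms
proof (induction l arbitrary: x)
  case (Cons a l)
  define x' B where "x' = x - {a}" and "B = chain_bottom l x'"
  have x': "x' \<subseteq> set l" "a \<notin> x'" using Cons.prems unfolding x'_def by auto
  then have fin: "finite x'" by (meson finite_subset List.finite_set)
  have IH: "card x' + card B \<le> length l"
    using Cons.IH[of x'] Cons.prems(1) x'(1) unfolding B_def by simp
  have B: "finite B" "a \<notin> B"
    using chain_bottom_subset[of l x'] fin x'(2) unfolding B_def by (auto intro: finite_subset)
  have b: "chain_bottom (a # l) x = (if a \<in> x \<and> card x' + card B < length l then insert a B else B)"
    unfolding B_def x'_def by (simp add: chain_bottom.simps(2) Let_def)
  show ?case
  proof (cases "a \<in> x")
    case True
    then have "x = insert a x'" unfolding x'_def by auto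
    then show ?thesis using IH B x' fin unfolding b by simp
  next
    case False
    then show ?thesis using IH unfolding b x'_def by simp
  qed
qed auto

text \<open>A chain p_1 < ... < p_r of \<open>l\<close> yields two chains of \<open>a # l\<close>:
  p_1 < ... < p_r < p_r + a, which keeps the old bottom, and p_1 + a < ... < p_(r-1) + a, with
  bottom p_1 + a. The cases \<open>skip\<close> and \<open>top\<close> make up the first one,
  \<open>top\<close> being its last element; \<open>below\<close> makes up the second.\<close>

lemma chain_bottom_Cons_cases:
  assumes "distinct (a # l)" "x \<subseteq> set (a # l)"
  obtains
    (skip) "a \<notin> x" "x \<subseteq> set l" "chain_bottom (a # l) x = chain_bottom l x" "a \<notin> chain_bottom l x"
  | (top) x' where "x = insert a x'" "a \<notin> x'" "x' \<subseteq> set l" "card x = Suc (card x')"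
      "chain_bottom (a # l) x = chain_bottom l x'" "a \<notin> chain_bottom l x'"
      "card x' + card (chain_bottom l x') = length l"
  | (below) x' where "x = insert a x'" "a \<notin> x'" "x' \<subseteq> set l" "card x = Suc (card x')"
      "chain_bottom (a # l) x = insert a (chain_bottom l x')" "a \<notin> chain_bottom l x'"
      "card (chain_bottom (a # l) x) = Suc (card (chain_bottom l x'))"
      "card x' + card (chain_bottom l x') < length l"
proof (cases "a \<in> x")
  case False
  then show ?thesis using that(1) assms chain_bottom_subset[of l x] by (auto simp: chain_bottom.simps(2) Let_def)
next
  case True
  define x' where "x' = x - {a}"
  have x: "x = insert a x'" "a \<notin> x'" "x' \<subseteq> set l" using True assms unfolding x'_def by auto
  have fin: "finite x'" using x(3) by (meson finite_subset List.finite_set)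
  have c: "card x = Suc (card x')" using x fin by auto
  have sub: "chain_bottom l x' \<subseteq> x'" by (rule chain_bottom_subset)
  then have nin: "a \<notin> chain_bottom l x'" using x(2) by auto
  have fb: "finite (chain_bottom l x')" using sub fin by (rule finite_subset)
  have le: "card x' + card (chain_bottom l x') \<le> length l"
    using card_chain_bottom_le[of l x'] x assms by auto
  show ?thesis
  proof (cases "card x' + card (chain_bottom l x') < length l")
    case lt: True
    then have "chain_bottom (a # l) x = insert a (chain_bottom l x')"
      using True by (simp add: chain_bottom.simps(2) Let_def x'_def)
    then show ?thesis using that(3)[of x'] x c nin lt fb by auto
  next
    case False
    then have "chain_bottom (a # l) x = chain_bottom l x'"
      by (auto simp: chain_bottom.simps(2) Let_def x'_def)
    then show ?thesis using that(2)[of x'] x c nin le False by auto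
  qed
qed

text \<open>Bottoms contain \<open>a\<close> in the case \<open>below\<close> only, which separates
  it from the other two. In the mixed cases of \<open>skip\<close> and \<open>top\<close>, a set
  without \<open>a\<close> has at most the rank of the top of the old chain, so it lies below that
  top with \<open>a\<close> adjoined.\<close>

lemma chain_bottom_chain:
  assumes "distinct l" "x \<subseteq> set l" "y \<subseteq> set l" "chain_bottom l x = chain_bottom l y" "card x \<le> card y"
  shows "x \<subseteq> y"
  using assms
proof (induction l arbitrary: x y)
  case (Cons a l)
  have d: "distinct l" using Cons.prems by simp
  note cle = card_chain_bottom_le[OF d]
  note IH = Cons.IH[OF d]
  from Cons.prems(1,2) show ?case
  proof (cases rule: chain_bottom_Cons_cases)
    case x: skip
    from Cons.prems(1,3) show ?thesis
    proof (cases rule: chain_bottom_Cons_cases)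
      case y: skip
      then show ?thesis using x Cons.prems IH by auto
    next
      case y: (top y')
      have "card x \<le> card y'" using cle[OF x(2)] x(3) y(5,7) Cons.prems(4) by simp
      then show ?thesis using x y Cons.prems IH[of x y'] by auto
    next
      case y: (below y')
      then show ?thesis using x Cons.prems(4) by auto
    qed
  next
    case x: (top x')
    from Cons.prems(1,3) show ?thesis
    proof (cases rule: chain_bottom_Cons_cases)
      case y: skip
      have "card y \<le> card x'" using cle[OF y(2)] x(5,7) y(3) Cons.prems(4) by simp
      then show ?thesis using x Cons.prems(5) by auto
    next
      case y: (top y')
      then show ?thesis using x Cons.prems IH[of x' y'] by auto
    next
      case y: (below y')
      then show ?thesis using x Cons.prems(4) by auto
    qed
  next
    case x: (below x')
    from Cons.prems(1,3) show ?thesis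
    proof (cases rule: chain_bottom_Cons_cases)
      case y: skip
      then show ?thesis using x Cons.prems(4) by auto
    next
      case y: (top y')
      then show ?thesis using x Cons.prems(4) by auto
    next
      case y: (below y')
      have "chain_bottom l x' = chain_bottom l y'"
        using x(5,6) y(5,6) Cons.prems(4) by (metis Diff_insert_absorb)
      then show ?thesis using x y Cons.prems IH[of x' y'] by auto
    qed
  qed
qed simp



text \<open>The induction lifts a set of the old chain. If the bottom stays the same, the set is
  kept, or \<open>a\<close> is adjoined to the old top; if the bottom gains \<open>a\<close>, then
  \<open>a\<close> is adjoined to a set of rank \<open>i - 1\<close>.\<close>

lemma chain_bottom_saturated:
  assumes "distinct l" "x \<subseteq> set l" "card (chain_bottom l x) \<le> i"
    "i + card (chain_bottom l x) \<le> length l"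
  obtains y where "y \<subseteq> set l" "chain_bottom l y = chain_bottom l x" "card y = i"
proof -
  have "\<exists>y. y \<subseteq> set l \<and> chain_bottom l y = chain_bottom l x \<and> card y = i"
    using assms
  proof (induction l arbitrary: x i)
    case Nil
    then show ?case by auto
  next
    case (Cons a l)
    have d: "distinct l" "a \<notin> set l" using Cons.prems by simp_all
    note IH = Cons.IH[OF d(1)]
    have skip: "chain_bottom (a # l) y = chain_bottom l y" if "y \<subseteq> set l" for y
    proof -
      have "a \<notin> y" using that d by auto
      then show ?thesis by (simp add: chain_bottom.simps(2) Let_def)
    qed
    have add: "chain_bottom (a # l) (insert a y) =
        (if card y + card (chain_bottom l y) < length l then insert a (chain_bottom l y) else chain_bottom l y)"
        "card (insert a y) = Suc (card y)" if "y \<subseteq> set l" for y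
    proof -
      have "a \<notin> y" "finite y" using that d by (auto intro: finite_subset)
      then show "card (insert a y) = Suc (card y)" "chain_bottom (a # l) (insert a y) =
        (if card y + card (chain_bottom l y) < length l then insert a (chain_bottom l y) else chain_bottom l y)"
        by (simp_all add: chain_bottom.simps(2) Let_def)
    qed
    \<comment> \<open>This settles \<open>skip\<close> and \<open>top\<close> together: the chain
      keeps its bottom and gains a single rank. That rank, where
      \<open>i + card (chain_bottom l x')\<close> exceeds \<open>length l\<close>, is filled by the
      old top with \<open>a\<close> adjoined.\<close>
    have ext: ?case if x': "x' \<subseteq> set l" "chain_bottom (a # l) x = chain_bottom l x'" for x'
    proof (cases "i + card (chain_bottom l x') \<le> length l")
      case True
      have "card (chain_bottom l x') \<le> i" using Cons.prems(3) unfolding x'(2) .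
      then obtain y where y: "y \<subseteq> set l" "chain_bottom l y = chain_bottom l x'" "card y = i"
        using IH[OF x'(1) _ True] by blast
      have "y \<subseteq> set (a # l)" using y(1) by auto
      then show ?thesis using skip[OF y(1)] y(2,3) x'(2) by metis
    next
      case False
      have Bx: "card (chain_bottom l x') \<le> card x'"
        using chain_bottom_subset x' by (metis card_mono finite_subset List.finite_set)
      note xl = card_chain_bottom_le[OF d(1) x'(1)]
      have i: "i = Suc (length l - card (chain_bottom l x'))"
        using Cons.prems(4) False xl unfolding x'(2) by simp
      have "card (chain_bottom l x') \<le> length l - card (chain_bottom l x')"
        "length l - card (chain_bottom l x') + card (chain_bottom l x') \<le> length l"
        using Bx xl by linarith+
      then obtain y where y: "y \<subseteq> set l" "chain_bottom l y = chain_bottom l x'"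
          "card y = length l - card (chain_bottom l x')"
        using IH[OF x'(1)] by blast
      have "chain_bottom (a # l) (insert a y) = chain_bottom l x'"
        using add(1)[OF y(1)] y(2,3) xl by simp
      moreover have "insert a y \<subseteq> set (a # l)" using y(1) by auto
      ultimately show ?thesis using add(2)[OF y(1)] y(3) i x'(2) by metis
    qed
    from Cons.prems(1,2) show ?case
    proof (cases rule: chain_bottom_Cons_cases)
      case skip
      then show ?thesis using ext by blast
    next
      case (top x')
      then show ?thesis using ext by blast
    next
      case (below x')
      have *: "card (chain_bottom l x') \<le> i - 1" "i - 1 + card (chain_bottom l x') < length l" "i \<ge> 1"
        using Cons.prems(3,4) unfolding below(7) by auto
      then obtain y where y: "y \<subseteq> set l" "chain_bottom l y = chain_bottom l x'" "card y = i - 1"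
        using IH[OF below(3) *(1)] by (meson less_imp_le)
      have "chain_bottom (a # l) (insert a y) = chain_bottom (a # l) x"
        using add(1)[OF y(1)] y(2,3) *(2) below(5) by simp
      moreover have "insert a y \<subseteq> set (a # l)" using y(1) by auto
      moreover have "card (insert a y) = i" using add(2)[OF y(1)] y(3) *(3) by simp
      ultimately show ?thesis by blast
    qed
  qed
  then show ?thesis using that by blast
qed

text \<open>
  Hansel's property: the complement of the middle of three consecutive elements of a chain, taken
  in the interval between the outer two, lies on a shorter chain.
\<close>

lemma chain_bottom_complement:
  assumes "distinct l" "x \<subseteq> set l" "y \<subseteq> set l" "z \<subseteq> set l"
    "chain_bottom l y = chain_bottom l x" "chain_bottom l z = chain_bottom l x"
    "card y = Suc (card x)" "card z = Suc (card y)"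
  shows "card (chain_bottom l x) < card (chain_bottom l (x \<union> (z - y)))"
  using assms
proof (induction l arbitrary: x y z)
  case (Cons a l)
  have d: "distinct l" "a \<notin> set l" using Cons.prems by simp_all
  note IH = Cons.IH[OF d(1)]
  note cle = card_chain_bottom_le[OF d(1)]
  have xy: "x \<subseteq> y" and yz: "y \<subseteq> z"
    using chain_bottom_chain[OF Cons.prems(1)] Cons.prems by (metis le_SucI le_refl)+
  have finz: "finite z" using Cons.prems(4) by (meson finite_subset List.finite_set)
  have fin: "finite x" "finite y" using finz xy yz by (auto intro: finite_subset)
  show ?case
  \<comment> \<open>If the bottom of the common chain contains \<open>a\<close>, removing
    \<open>a\<close> from all three sets leaves consecutive sets of an old chain. Otherwise only the
    top of the common chain can contain \<open>a\<close>.\<close>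
  proof (cases "a \<in> chain_bottom (a # l) x")
    case True
    have below: "\<exists>w'. w = insert a w' \<and> a \<notin> w' \<and> w' \<subseteq> set l \<and> card w = Suc (card w') \<and>
        chain_bottom (a # l) w = insert a (chain_bottom l w') \<and> a \<notin> chain_bottom l w' \<and>
        card (chain_bottom (a # l) w) = Suc (card (chain_bottom l w')) \<and>
        card w' + card (chain_bottom l w') < length l"
      if "w \<subseteq> set (a # l)" "chain_bottom (a # l) w = chain_bottom (a # l) x" for w
      using Cons.prems(1) that(1)
    proof (cases rule: chain_bottom_Cons_cases)
      case skip
      then show ?thesis using True that by simp
    next
      case (top w')
      then show ?thesis using True that by simp
    next
      case (below w')
      then show ?thesis by blast
    qed
    obtain x' where x: "x = insert a x'" "a \<notin> x'" "x' \<subseteq> set l" "card x = Suc (card x')"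
        "chain_bottom (a # l) x = insert a (chain_bottom l x')" "a \<notin> chain_bottom l x'"
        "card (chain_bottom (a # l) x) = Suc (card (chain_bottom l x'))"
      using below[OF Cons.prems(2) refl] by blast
    obtain y' where y: "y = insert a y'" "a \<notin> y'" "y' \<subseteq> set l" "card y = Suc (card y')"
        "chain_bottom (a # l) y = insert a (chain_bottom l y')" "a \<notin> chain_bottom l y'"
      using below[OF Cons.prems(3,5)] by blast
    obtain z' where z: "z = insert a z'" "a \<notin> z'" "z' \<subseteq> set l" "card z = Suc (card z')"
        "chain_bottom (a # l) z = insert a (chain_bottom l z')" "a \<notin> chain_bottom l z'"
        "card z' + card (chain_bottom l z') < length l"
      using below[OF Cons.prems(4,6)] by blast
    have eq: "chain_bottom l y' = chain_bottom l x'" "chain_bottom l z' = chain_bottom l x'"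
      using x y z Cons.prems(5,6) by (metis Diff_insert_absorb)+
    define u where "u = x' \<union> (z' - y')"
    have u: "x \<union> (z - y) = insert a u" "a \<notin> u" "u \<subseteq> set l" using x y z unfolding u_def by auto
    have lt: "card (chain_bottom l x') < card (chain_bottom l u)"
      unfolding u_def using Cons.prems(7,8) x y z eq by (intro IH) auto
    have "x' \<subseteq> y'" "y' \<subseteq> z'" using xy yz x y z by auto
    then have "card u = card x' + (card z' - card y')"
      unfolding u_def using fin finz x y z
      by (subst card_Un_disjoint) (auto simp: card_Diff_subset finite_subset)
    then have cu: "card u = Suc (card x')" using Cons.prems(7,8) x y z by simp
    have ub: "chain_bottom (a # l) (insert a u) =
        (if card u + card (chain_bottom l u) < length l then insert a (chain_bottom l u) else chain_bottom l u)"
      using u by (simp add: chain_bottom.simps(2) Let_def)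
    have fu: "finite (chain_bottom l u)" "a \<notin> chain_bottom l u"
      using chain_bottom_subset[of l u] u by (auto intro: finite_subset)
    show ?thesis
    proof (cases "card u + card (chain_bottom l u) < length l")
      case True
      then show ?thesis using ub u(1) x(7) lt fu by simp
    next
      case False
      \<comment> \<open>Here \<open>u\<close> tops its chain while \<open>x'\<close> is at least three ranks below the top of its own.\<close>
      have "card (chain_bottom l x') + 2 \<le> card (chain_bottom l u)"
        using False cu z(7) Cons.prems(7,8) x(4) y(4) z(4) unfolding eq(2) by linarith
      then show ?thesis using ub u(1) x(7) False by simp
    qed
  next
    case nin: False
    have inc: "w = insert a w' \<and> a \<notin> w' \<and> w' \<subseteq> set l \<and> card w = Suc (card w') \<and>
        chain_bottom (a # l) w = chain_bottom l w' \<and>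
        card w' + card (chain_bottom l w') = length l"
      if "w \<subseteq> set (a # l)" "chain_bottom (a # l) w = chain_bottom (a # l) x" "a \<in> w" "w' = w - {a}" for w w'
      using Cons.prems(1) that(1)
    proof (cases rule: chain_bottom_Cons_cases)
      case skip
      then show ?thesis using nin that by simp
    next
      case (top w')
      then show ?thesis using that by auto
    next
      case (below w')
      then show ?thesis using that nin by auto
    qed
    have exc: "w \<subseteq> set l \<and> chain_bottom (a # l) w = chain_bottom l w"
      if "w \<subseteq> set (a # l)" "a \<notin> w" for w
      using that by (auto simp: chain_bottom.simps(2) Let_def)
    \<comment> \<open>A set of this chain that contains \<open>a\<close> is its top, and
      \<open>y\<close> has \<open>z\<close> above it.\<close>
    have any: "a \<notin> y"
    proof
      assume ay: "a \<in> y"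
      then have az: "a \<in> z" using yz by auto
      have "card (y - {a}) = card (z - {a})"
        using inc[OF Cons.prems(3,5) ay refl] inc[OF Cons.prems(4,6) az refl] Cons.prems(5,6)
        by (metis add_right_cancel)
      then show False
        using inc[OF Cons.prems(3,5) ay refl] inc[OF Cons.prems(4,6) az refl] Cons.prems(8) by simp
    qed
    then have anx: "a \<notin> x" using xy by auto
    note x = exc[OF Cons.prems(2) anx] and y = exc[OF Cons.prems(3) any]
    show ?thesis
    proof (cases "a \<in> z")
      case False
      note z = exc[OF Cons.prems(4) False]
      define u where "u = x \<union> (z - y)"
      have "a \<notin> u" using anx False unfolding u_def by auto
      then have "chain_bottom (a # l) u = chain_bottom l u" by (simp add: chain_bottom.simps(2) Let_def)
      moreover have "card (chain_bottom l x) < card (chain_bottom l u)"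
        unfolding u_def using x y z Cons.prems(5-8) by (intro IH) auto
      ultimately show ?thesis using x unfolding u_def by simp
    next
      case True
      define z' where "z' = z - {a}"
      note z = inc[OF Cons.prems(4,6) True z'_def]
      \<comment> \<open>Without \<open>a\<close>, the set \<open>z\<close> is the top of the old
        chain and hence equals \<open>y\<close>. The complement is then \<open>insert a x\<close>;
        as \<open>x\<close> lies below the old top, this set belongs to the second chain, whose
        bottom has the extra element \<open>a\<close>.\<close>
      have "y \<subseteq> z'" using yz any unfolding z'_def by auto
      moreover have "card z' = card y" using z Cons.prems(8) by simp
      ultimately have yz': "y = z'" using finz unfolding z'_def
        by (metis card_subset_eq finite_Diff)
      have u: "x \<union> (z - y) = insert a x" using z yz' by auto
      have lt: "card x + card (chain_bottom l x) < length l"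
        using z x y yz' Cons.prems(5,7) by simp
      have fu: "finite (chain_bottom l x)" "a \<notin> chain_bottom l x"
        using chain_bottom_subset[of l x] fin anx by (auto intro: finite_subset)
      have "chain_bottom (a # l) (insert a x) = insert a (chain_bottom l x)"
        using lt anx by (simp add: chain_bottom.simps(2) Let_def)
      then show ?thesis using u x fu by simp
    qed
  qed
qed simp

section \<open>Up-sets of a Boolean lattice and their traces on the chains\<close>

definition up_closed :: "'a set \<Rightarrow> 'a set set \<Rightarrow> bool" where
  "up_closed S U \<longleftrightarrow> U \<subseteq> Pow S \<and> (\<forall>x\<in>U. \<forall>y. x \<subseteq> y \<longrightarrow> y \<subseteq> S \<longrightarrow> y \<in> U)"

text \<open>Every symmetric chain passes through the middle rank, so the sets of that rank represent
  all chains.\<close>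

lemma card_chain_bottoms_le:
  assumes "distinct l"
  shows "card (chain_bottom l ` Pow (set l)) \<le> length l choose (length l div 2)"
proof -
  let ?M = "{y. y \<subseteq> set l \<and> card y = length l div 2}"
  have fin: "finite ?M" by (rule finite_subset[of _ "Pow (set l)"]) auto
  have "chain_bottom l ` Pow (set l) \<subseteq> chain_bottom l ` ?M"
  proof
    fix B assume "B \<in> chain_bottom l ` Pow (set l)"
    then obtain x where x: "x \<subseteq> set l" "B = chain_bottom l x" by auto
    have "card (chain_bottom l x) \<le> card x"
      using chain_bottom_subset x by (metis card_mono finite_subset List.finite_set)
    then have "card (chain_bottom l x) \<le> length l div 2"
        "length l div 2 + card (chain_bottom l x) \<le> length l"
      using card_chain_bottom_le[OF assms x(1)] by linarith+
    then obtain y where "y \<subseteq> set l" "chain_bottom l y = chain_bottom l x" "card y = length l div 2"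
      using chain_bottom_saturated[OF assms x(1)] by blast
    then show "B \<in> chain_bottom l ` ?M" using x by auto
  qed
  then have "card (chain_bottom l ` Pow (set l)) \<le> card ?M"
    using fin by (meson card_image_le card_mono finite_imageI le_trans)
  also have "\<dots> = length l choose (length l div 2)"
    using n_subsets[of "set l" "length l div 2"] assms by (simp add: distinct_card)
  finally show ?thesis .
qed

text \<open>Let p be the lowest set in the difference of the traces, q another one at least two
  ranks higher, and let y, z follow p on the chain. The complement u of y between p and z lies on a
  shorter chain, where \<open>above\<close> makes \<open>U\<close> and \<open>V\<close> agree. It
  contains p, so it is in \<open>V\<close> and hence in \<open>U\<close>; then q, which contains u,
  is in \<open>U\<close> too, a contradiction. So the difference has at most two elements, and
  equality modulo 3 leaves none.\<close>

lemma up_closed_eq_on_chain: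
  assumes l: "distinct l" and U: "up_closed (set l) U" and V: "up_closed (set l) V"
    and above: "\<And>y. y \<subseteq> set l \<Longrightarrow> card B < card (chain_bottom l y) \<Longrightarrow> y \<in> U \<longleftrightarrow> y \<in> V"
    and sub: "{y \<in> U. chain_bottom l y = B} \<subseteq> {y \<in> V. chain_bottom l y = B}"
    and mod3: "card {y \<in> U. chain_bottom l y = B} mod 3 = card {y \<in> V. chain_bottom l y = B} mod 3"
  shows "{y \<in> U. chain_bottom l y = B} = {y \<in> V. chain_bottom l y = B}"
proof -
  define E where "E = {y \<in> V. chain_bottom l y = B} - {y \<in> U. chain_bottom l y = B}"
  have "V \<subseteq> Pow (set l)" using V unfolding up_closed_def by auto
  then have finV: "finite V" by (meson List.finite_set finite_Pow_iff finite_subset)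
  have E: "y \<subseteq> set l" "y \<in> V" "y \<notin> U" "chain_bottom l y = B" if "y \<in> E" for y
    using that \<open>V \<subseteq> Pow (set l)\<close> unfolding E_def by blast+
  have finE: "finite E" using finV unfolding E_def by auto
  have "E = {}"
  proof (rule ccontr)
    assume ne: "E \<noteq> {}"
    obtain p where p: "p \<in> E" "\<And>q. q \<in> E \<Longrightarrow> card p \<le> card q"
      using ne ex_has_least_nat[of "\<lambda>x. x \<in> E" _ card] by blast
    have le: "card q \<le> Suc (card p)" if q: "q \<in> E" for q
    proof (rule ccontr)
      assume "\<not> card q \<le> Suc (card p)"
      then have lt: "card p + 2 \<le> card q" by simp
      have Bp: "card (chain_bottom l p) \<le> card p"
        using chain_bottom_subset E(1)[OF p(1)] by (metis card_mono finite_subset List.finite_set)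
      have Bq: "card q + card (chain_bottom l p) \<le> length l"
        using card_chain_bottom_le[OF l E(1)[OF q]] E(4)[OF q] E(4)[OF p(1)] by simp
      obtain y where y: "y \<subseteq> set l" "chain_bottom l y = chain_bottom l p" "card y = card p + 1"
        by (rule chain_bottom_saturated[OF l E(1)[OF p(1)], of "card p + 1"]) (use Bp Bq lt in linarith)+
      obtain z where z: "z \<subseteq> set l" "chain_bottom l z = chain_bottom l p" "card z = card p + 2"
        by (rule chain_bottom_saturated[OF l E(1)[OF p(1)], of "card p + 2"]) (use Bp Bq lt in linarith)+
      have pz: "p \<subseteq> z"
        by (rule chain_bottom_chain[OF l E(1)[OF p(1)] z(1) z(2)[symmetric]]) (simp add: z(3))
      have zq: "z \<subseteq> q"
        by (rule chain_bottom_chain[OF l z(1) E(1)[OF q]])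
          (simp_all only: z(2,3) lt E(4)[OF q] E(4)[OF p(1)])
      define u where "u = p \<union> (z - y)"
      have u: "p \<subseteq> u" "u \<subseteq> z" "u \<subseteq> set l" using pz z(1) E(1)[OF p(1)] unfolding u_def by auto
      have "card (chain_bottom l p) < card (chain_bottom l u)"
        unfolding u_def by (rule chain_bottom_complement[OF l E(1)[OF p(1)] y(1) z(1) y(2) z(2)])
          (use y z in simp_all)
      then have iff: "u \<in> U \<longleftrightarrow> u \<in> V" using above u(3) E(4)[OF p(1)] by simp
      have "u \<in> V" using V E(2)[OF p(1)] u(1,3) unfolding up_closed_def by metis
      then have "u \<in> U" using iff by simp
      moreover have "u \<subseteq> q" using u(2) zq by blast
      ultimately have "q \<in> U" using U E(1)[OF q] unfolding up_closed_def by metis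
      then show False using E(3)[OF q] by simp
    qed
    have "inj_on card E"
    proof (rule inj_onI)
      fix x y assume xy: "x \<in> E" "y \<in> E" "card x = card y"
      have "chain_bottom l x = chain_bottom l y" using E(4)[OF xy(1)] E(4)[OF xy(2)] by simp
      then show "x = y"
        using chain_bottom_chain[OF l E(1)[OF xy(1)] E(1)[OF xy(2)]]
          chain_bottom_chain[OF l E(1)[OF xy(2)] E(1)[OF xy(1)]] xy(3) by simp
    qed
    moreover have "card ` E \<subseteq> {card p, Suc (card p)}" 
    proof
      fix i assume "i \<in> card ` E"
      then obtain q where "q \<in> E" "i = card q" by blast
      then show "i \<in> {card p, Suc (card p)}" using p(2)[of q] le[of q] by auto
    qed
    ultimately have "card E \<le> card {card p, Suc (card p)}"
      by (intro card_inj_on_le) auto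
    then have c2: "card E \<le> 2" by simp
    have "card E \<ge> 1" using ne finE by (simp add: Suc_leI card_gt_0_iff)
    moreover have "card E = card {y \<in> V. chain_bottom l y = B} - card {y \<in> U. chain_bottom l y = B}"
      unfolding E_def using sub finV by (intro card_Diff_subset) (auto intro: finite_subset)
    moreover have "card {y \<in> U. chain_bottom l y = B} \<le> card {y \<in> V. chain_bottom l y = B}"
      using sub finV by (intro card_mono) auto
    ultimately have "card {y \<in> V. chain_bottom l y = B} = card {y \<in> U. chain_bottom l y = B} + card E"
      by simp
    then show False using \<open>card E \<ge> 1\<close> c2 mod3 by presburger
  qed
  then show ?thesis using sub unfolding E_def by blast
qed

text \<open>
  Two up-sets that agree on all shorter chains differ in at most two elements of a chain, so the
  number of elements modulo 3 on each of the chains determines an up-set.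
\<close>

theorem card_up_closed_le:
  assumes "finite S"
  shows "card {U. up_closed S U} \<le> 3 ^ (card S choose (card S div 2))"
proof -
  obtain l where l: "set l = S" "distinct l" using assms finite_distinct_list by blast
  let ?b = "chain_bottom l"
  define code where "code U = (\<lambda>B\<in>?b ` Pow S. card {y \<in> U. ?b y = B} mod 3)" for U
  have "inj_on code {U. up_closed S U}"
  proof (rule inj_onI, rule ccontr)
    fix U V assume UV: "U \<in> {U. up_closed S U}" "V \<in> {U. up_closed S U}" "code U = code V" "U \<noteq> V"
    have up: "up_closed (set l) U" "up_closed (set l) V" using UV l by auto
    then have subs: "U \<subseteq> Pow S" "V \<subseteq> Pow S" using l unfolding up_closed_def by auto
    define W where "W = {x \<in> Pow S. (x \<in> U) \<noteq> (x \<in> V)}"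
    have "W \<noteq> {}" "finite W" using UV(4) subs assms unfolding W_def by auto
    \<comment> \<open>Larger bottoms mean shorter chains. A disagreement \<open>x\<close> on a
      shortest possible chain ensures that \<open>U\<close> and \<open>V\<close> agree on all chains
      shorter than its own, as \<open>above\<close> demands.\<close>
    then have "Max ((\<lambda>y. card (?b y)) ` W) \<in> (\<lambda>y. card (?b y)) ` W" by (intro Max_in) auto
    then obtain x where x: "x \<in> W" "card (?b x) = Max ((\<lambda>y. card (?b y)) ` W)" by auto
    then have xmax: "card (?b y) \<le> card (?b x)" if "y \<in> W" for y
      using that \<open>finite W\<close> by simp
    have above: "y \<in> U \<longleftrightarrow> y \<in> V" if "y \<subseteq> set l" "card (?b x) < card (?b y)" for y
      using xmax[of y] that l unfolding W_def by auto
    have xS: "x \<subseteq> S" using x(1) unfolding W_def by auto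
    have mod3: "card {y \<in> U. ?b y = ?b x} mod 3 = card {y \<in> V. ?b y = ?b x} mod 3"
      using fun_cong[OF UV(3), of "?b x"] xS unfolding code_def by simp
    \<comment> \<open>The traces of two up-sets on a chain are final segments of it, hence nested.\<close>
    have "{y \<in> U. ?b y = ?b x} \<subseteq> {y \<in> V. ?b y = ?b x} \<or> {y \<in> V. ?b y = ?b x} \<subseteq> {y \<in> U. ?b y = ?b x}"
    proof (rule ccontr)
      assume "\<not> ?thesis"
      then obtain p q where pq: "p \<in> U" "p \<notin> V" "?b p = ?b x" "q \<in> V" "q \<notin> U" "?b q = ?b x" by blast
      have "p \<subseteq> set l" "q \<subseteq> set l" using pq subs l by auto
      then have "p \<subseteq> q \<or> q \<subseteq> p"
        using chain_bottom_chain[OF l(2), of p q] chain_bottom_chain[OF l(2), of q p] pq(3,6)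
        by (cases "card p \<le> card q") auto
      then show False using pq up \<open>p \<subseteq> set l\<close> \<open>q \<subseteq> set l\<close> unfolding up_closed_def by blast
    qed
    then have "{y \<in> U. ?b y = ?b x} = {y \<in> V. ?b y = ?b x}"
    proof
      assume "{y \<in> U. ?b y = ?b x} \<subseteq> {y \<in> V. ?b y = ?b x}"
      then show ?thesis using up_closed_eq_on_chain[OF l(2) up above] mod3 by simp
    next
      assume "{y \<in> V. ?b y = ?b x} \<subseteq> {y \<in> U. ?b y = ?b x}"
      then show ?thesis
        by (intro up_closed_eq_on_chain[OF l(2) up(2,1), symmetric]) (simp_all add: above mod3)
    qed
    then show False using x(1) unfolding W_def by auto
  qed
  moreover have "code ` {U. up_closed S U} \<subseteq> ?b ` Pow S \<rightarrow>\<^sub>E {..<3}"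
    unfolding code_def by auto
  moreover have "finite (?b ` Pow S \<rightarrow>\<^sub>E {..<3::nat})" using assms by (intro finite_PiE) auto
  ultimately have "card {U. up_closed S U} \<le> card (?b ` Pow S \<rightarrow>\<^sub>E {..<3::nat})"
    by (metis card_image card_mono)
  also have "\<dots> = 3 ^ card (?b ` Pow S)" using assms by (subst card_PiE) auto
  also have "\<dots> \<le> 3 ^ (card S choose (card S div 2))"
    using card_chain_bottoms_le[OF l(2)] l by (intro power_increasing) (auto simp: distinct_card[symmetric])
  finally show ?thesis .
qed

subsection \<open>Copies of a Boolean lattice\<close>

text \<open>Since {i} is not contained in its complement, \<open>f {i}\<close> has an element
  \<open>\<phi> i\<close> outside the image of the complement. It lies in \<open>f x\<close> exactly
  when i is in \<open>x\<close>: if so, \<open>f {i}\<close> is below \<open>f x\<close>, and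
  otherwise \<open>f x\<close> is below the image of the complement.\<close>

lemma strong_embedding_coordinates:
  assumes "strong_embedding m N f"
  obtains \<phi> where "inj_on \<phi> {1..m}" "\<phi> ` {1..m} \<subseteq> {1..N}"
    "\<And>x. x \<subseteq> {1..m} \<Longrightarrow> f x \<inter> \<phi> ` {1..m} = \<phi> ` x"
proof -
  have f: "f x \<subseteq> {1..N}" if "x \<subseteq> {1..m}" for x
    using assms that unfolding strong_embedding_def boolean_lattice_def by blast
  have iff: "f x \<subseteq> f y \<longleftrightarrow> x \<subseteq> y" if "x \<subseteq> {1..m}" "y \<subseteq> {1..m}" for x y
    using assms that unfolding strong_embedding_def boolean_lattice_def by blast
  have "\<exists>j. j \<in> f {i} \<and> j \<notin> f ({1..m} - {i})" if i: "i \<in> {1..m}" for i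
    using iff[of "{i}" "{1..m} - {i}"] i by blast
  then obtain \<phi> where \<phi>: "\<phi> i \<in> f {i}" "\<phi> i \<notin> f ({1..m} - {i})" if "i \<in> {1..m}" for i
    by metis
  have mem: "\<phi> i \<in> f x \<longleftrightarrow> i \<in> x" if "i \<in> {1..m}" "x \<subseteq> {1..m}" for i x
  proof
    assume "i \<in> x"
    then have "f {i} \<subseteq> f x" using iff[of "{i}" x] that by blast
    then show "\<phi> i \<in> f x" using \<phi>(1)[OF that(1)] by blast
  next
    assume *: "\<phi> i \<in> f x"
    show "i \<in> x"
    proof (rule ccontr)
      assume "i \<notin> x"
      then have "f x \<subseteq> f ({1..m} - {i})" using iff[of x "{1..m} - {i}"] that by blast
      then show False using * \<phi>(2)[OF that(1)] by blast
    qed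
  qed
  show ?thesis
  proof (rule that)
    show "inj_on \<phi> {1..m}"
    proof (rule inj_onI)
      fix i j assume ij: "i \<in> {1..m}" "j \<in> {1..m}" "\<phi> i = \<phi> j"
      then show "i = j" using mem[of j "{i}"] \<phi>(1)[of i] by simp
    qed
    show "\<phi> ` {1..m} \<subseteq> {1..N}"
    proof
      fix j assume "j \<in> \<phi> ` {1..m}"
      then obtain i where "i \<in> {1..m}" "j = \<phi> i" by blast
      then show "j \<in> {1..N}" using \<phi>(1)[of i] f[of "{i}"] by blast
    qed
    show "f x \<inter> \<phi> ` {1..m} = \<phi> ` x" if "x \<subseteq> {1..m}" for x
      using mem that by blast
  qed
qed

lemma strong_embedding_le: "strong_embedding m N f \<Longrightarrow> m \<le> N"
  by (erule strong_embedding_coordinates) (metis card_atLeastAtMost card_inj_on_le diff_Suc_1 finite_atLeastAtMost)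

text \<open>Images are counted instead of embeddings, so that the automorphisms of the lattice do
  not contribute a factor m!.\<close>

definition lattice_copies :: "nat \<Rightarrow> nat \<Rightarrow> nat set set set" where
  "lattice_copies m N = {f ` boolean_lattice m | f. strong_embedding m N f}"

lemma card_lattice_copies_le:
  "card (lattice_copies m N) \<le> (N choose m) * (3 ^ (m choose (m div 2))) ^ (N - m)"
proof -
  \<comment> \<open>\<open>S\<close> holds the \<open>m\<close> coordinates that copy those of the
    small lattice; for every other coordinate \<open>j\<close>, the up-set \<open>U j\<close>
    consists of the traces \<open>y\<close> on \<open>S\<close> whose members of the copy contain
    \<open>j\<close>.\<close>
  define decode where
    "decode = (\<lambda>(S, U). (\<lambda>y. y \<union> {j \<in> {1..N} - S. y \<in> U j}) ` Pow S)"
  define \<S> where "\<S> = {S. S \<subseteq> {1..N} \<and> card S = m}"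
  define \<U> where "\<U> = (\<lambda>S. ({1..N} - S) \<rightarrow>\<^sub>E {U. up_closed S U})"
  have fin\<S>: "finite \<S>" unfolding \<S>_def by (rule finite_subset[of _ "Pow {1..N}"]) auto
  have S: "finite S" "card ({1..N} - S) = N - m" "card S = m" if "S \<in> \<S>" for S
  proof -
    show "finite S" using that unfolding \<S>_def by (auto intro: finite_subset)
    then show "card ({1..N} - S) = N - m" "card S = m"
      using that unfolding \<S>_def by (auto simp: card_Diff_subset)
  qed
  have finup: "finite {U. up_closed S U}" if "S \<in> \<S>" for S
    by (rule finite_subset[of _ "Pow (Pow S)"]) (use S(1)[OF that] in \<open>auto simp: up_closed_def\<close>)
  have fin\<U>: "finite (\<U> S)" if "S \<in> \<S>" for S
    unfolding \<U>_def using finup[OF that] by (intro finite_PiE) auto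
  have card\<U>: "card (\<U> S) \<le> (3 ^ (m choose (m div 2))) ^ (N - m)" if "S \<in> \<S>" for S
    unfolding \<U>_def
    using card_up_closed_le[OF S(1)[OF that]] S(2,3)[OF that]
    by (simp add: card_PiE power_mono)
  have "lattice_copies m N \<subseteq> decode ` Sigma \<S> \<U>"
  proof
    fix X assume "X \<in> lattice_copies m N"
    then obtain f where X: "X = f ` boolean_lattice m" and f: "strong_embedding m N f"
      unfolding lattice_copies_def by auto
    obtain \<phi> where \<phi>: "inj_on \<phi> {1..m}" "\<phi> ` {1..m} \<subseteq> {1..N}"
      "\<And>x. x \<subseteq> {1..m} \<Longrightarrow> f x \<inter> \<phi> ` {1..m} = \<phi> ` x"
      using strong_embedding_coordinates[OF f] by blast
    define S where "S = \<phi> ` {1..m}"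
    define U where "U = (\<lambda>j\<in>{1..N} - S. {\<phi> ` x | x. x \<subseteq> {1..m} \<and> j \<in> f x})"
    have "card S = m" unfolding S_def using card_image[OF \<phi>(1)] by simp
    then have S\<S>: "S \<in> \<S>" using \<phi>(2) unfolding \<S>_def S_def by blast
    have up: "up_closed S {\<phi> ` x | x. x \<subseteq> {1..m} \<and> j \<in> f x}" for j
      unfolding up_closed_def
    proof (intro conjI ballI allI impI)
      show "{\<phi> ` x | x. x \<subseteq> {1..m} \<and> j \<in> f x} \<subseteq> Pow S" unfolding S_def by blast
    next
      fix y z assume "y \<in> {\<phi> ` x | x. x \<subseteq> {1..m} \<and> j \<in> f x}" and z: "y \<subseteq> z" "z \<subseteq> S"
      then obtain x where x: "y = \<phi> ` x" "x \<subseteq> {1..m}" "j \<in> f x" by blast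
      define x' where "x' = {i \<in> {1..m}. \<phi> i \<in> z}"
      have x': "x' \<subseteq> {1..m}" "x \<subseteq> x'" "z = \<phi> ` x'"
        using x z unfolding x'_def S_def by auto
      then have "f x \<subseteq> f x'"
        using f x(2) unfolding strong_embedding_def boolean_lattice_def by blast
      then show "z \<in> {\<phi> ` x | x. x \<subseteq> {1..m} \<and> j \<in> f x}" using x' x(3) by blast
    qed
    have U\<U>: "U \<in> \<U> S" unfolding \<U>_def U_def using up by simp
    have fx: "f x = \<phi> ` x \<union> {j \<in> {1..N} - S. \<phi> ` x \<in> U j}" if x: "x \<subseteq> {1..m}" for x
    proof -
      have "\<phi> ` x \<in> U j \<longleftrightarrow> j \<in> f x" if j: "j \<in> {1..N} - S" for j
      proof -
        have "x' = x" if "x' \<subseteq> {1..m}" "\<phi> ` x = \<phi> ` x'" for x'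
          using inj_on_image_eq_iff[OF \<phi>(1) x that(1)] that(2) by simp
        then show ?thesis using j x unfolding U_def by auto
      qed
      moreover have "f x \<subseteq> {1..N}"
        using f x unfolding strong_embedding_def boolean_lattice_def by blast
      ultimately show ?thesis using \<phi>(3)[OF x] unfolding S_def by blast
    qed
    have "X = decode (S, U)"
    proof -
      have "Pow S = (\<lambda>x. \<phi> ` x) ` Pow {1..m}" unfolding S_def by (simp add: image_Pow_surj)
      then have "decode (S, U) = (\<lambda>x. \<phi> ` x \<union> {j \<in> {1..N} - S. \<phi> ` x \<in> U j}) ` Pow {1..m}"
        unfolding decode_def by (simp add: image_image)
      also have "\<dots> = f ` Pow {1..m}" by (intro image_cong refl fx[symmetric]) simp
      finally show ?thesis unfolding X boolean_lattice_def by simp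
    qed
    then show "X \<in> decode ` Sigma \<S> \<U>" using S\<S> U\<U> by blast
  qed
  then have "card (lattice_copies m N) \<le> card (Sigma \<S> \<U>)"
    using fin\<S> fin\<U> by (intro surj_card_le) auto
  also have "\<dots> = (\<Sum>S\<in>\<S>. card (\<U> S))" using fin\<S> fin\<U> by (intro card_SigmaI) auto
  also have "\<dots> \<le> card \<S> * (3 ^ (m choose (m div 2))) ^ (N - m)"
    using sum_bounded_above[of \<S> "\<lambda>S. card (\<U> S)"] card\<U> by simp
  also have "card \<S> = N choose m" unfolding \<S>_def using n_subsets[of "{1..N}" m] by simp
  finally show ?thesis .
qed

lemma finite_lattice_copies: "finite (lattice_copies m N)"
  by (rule finite_subset[of _ "Pow (boolean_lattice N)"])
    (auto simp: lattice_copies_def strong_embedding_def boolean_lattice_def)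

section \<open>The t-chains inside a copy\<close>

lemma finite_t_chains: "finite (t_chains t m)"
proof (rule finite_subset)
  show "t_chains t m \<subseteq> Pow (boolean_lattice m)" unfolding t_chains_def subset_chain_def by blast
  show "finite (Pow (boolean_lattice m))" unfolding boolean_lattice_def by simp
qed

text \<open>Strong embeddings preserve and reflect inclusion. As the right side depends on
  \<open>f\<close> through its image only, all embeddings onto the same copy impose the same
  condition on a colouring.\<close>

lemma image_t_chains_eq:
  assumes "strong_embedding m N f"
  shows "(`) f ` t_chains t m = {A. subset.chain (f ` boolean_lattice m) A \<and> card A = t}"
proof (intro set_eqI iffI)
  have inj: "inj_on f (boolean_lattice m)" using assms unfolding strong_embedding_def by blast
  have iff: "f x \<subseteq> f y \<longleftrightarrow> x \<subseteq> y" if "x \<in> boolean_lattice m" "y \<in> boolean_lattice m" for x y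
    using assms that unfolding strong_embedding_def by blast
  fix A
  { assume "A \<in> (`) f ` t_chains t m"
    then obtain C where C: "A = f ` C" "C \<subseteq> boolean_lattice m" "card C = t"
        "\<And>x y. x \<in> C \<Longrightarrow> y \<in> C \<Longrightarrow> x \<subseteq> y \<or> y \<subseteq> x"
      unfolding t_chains_def subset_chain_def by blast
    have "card A = t" using C card_image[OF inj_on_subset[OF inj C(2)]] by simp
    moreover have "subset.chain (f ` boolean_lattice m) A"
      unfolding subset_chain_def
    proof (intro conjI ballI)
      show "A \<subseteq> f ` boolean_lattice m" using C by blast
      fix a b assume "a \<in> A" "b \<in> A"
      then obtain x y where "x \<in> C" "y \<in> C" "a = f x" "b = f y" using C(1) by blast
      then show "a \<subseteq> b \<or> b \<subseteq> a" using C(2,4) iff by (metis subsetD)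
    qed
    ultimately show "A \<in> {A. subset.chain (f ` boolean_lattice m) A \<and> card A = t}" by simp }
  { assume "A \<in> {A. subset.chain (f ` boolean_lattice m) A \<and> card A = t}"
    then have A: "A \<subseteq> f ` boolean_lattice m" "card A = t"
        "\<And>a b. a \<in> A \<Longrightarrow> b \<in> A \<Longrightarrow> a \<subseteq> b \<or> b \<subseteq> a"
      unfolding subset_chain_def by blast+
    then obtain C where C: "C \<subseteq> boolean_lattice m" "A = f ` C" by (meson subset_imageE)
    have "card C = t" using A(2) C card_image[OF inj_on_subset[OF inj C(1)]] by simp
    moreover have "x \<subseteq> y \<or> y \<subseteq> x" if "x \<in> C" "y \<in> C" for x y
      using A(3)[of "f x" "f y"] iff[of x y] iff[of y x] that C by blast
    ultimately have "C \<in> t_chains t m" using C(1) unfolding t_chains_def subset_chain_def by blast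
    then show "A \<in> (`) f ` t_chains t m" using C(2) by blast }
qed

lemma card_image_t_chains:
  assumes "strong_embedding m N f"
  shows "card ((`) f ` t_chains t m) = num_chains t m"
proof -
  have "inj_on ((`) f) (Pow (boolean_lattice m))"
    using assms unfolding strong_embedding_def by (blast intro: inj_on_image_Pow)
  moreover have "t_chains t m \<subseteq> Pow (boolean_lattice m)"
    unfolding t_chains_def subset_chain_def by blast
  ultimately show ?thesis unfolding num_chains_def by (meson card_image inj_on_subset)
qed

lemma image_t_chains_subset:
  assumes "strong_embedding m N f"
  shows "(`) f ` t_chains t m \<subseteq> t_chains t N"
proof -
  have "f ` boolean_lattice m \<subseteq> boolean_lattice N"
    using assms unfolding strong_embedding_def by blast
  then show ?thesis
    unfolding image_t_chains_eq[OF assms] unfolding t_chains_def subset_chain_def by auto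
qed

definition chain_images :: "nat \<Rightarrow> nat \<Rightarrow> nat \<Rightarrow> nat set set set set" where
  "chain_images t m N = {(`) f ` t_chains t m | f. strong_embedding m N f}"

lemma chain_images_eq:
  "chain_images t m N = (\<lambda>X. {A. subset.chain X A \<and> card A = t}) ` lattice_copies m N"
proof -
  have "chain_images t m N = (\<lambda>f. (`) f ` t_chains t m) ` {f. strong_embedding m N f}"
    unfolding chain_images_def by blast
  also have "\<dots> = (\<lambda>f. {A. subset.chain (f ` boolean_lattice m) A \<and> card A = t}) ` {f. strong_embedding m N f}"
    by (intro image_cong refl image_t_chains_eq) simp
  also have "\<dots> = (\<lambda>X. {A. subset.chain X A \<and> card A = t}) ` lattice_copies m N"
    unfolding lattice_copies_def by blast
  finally show ?thesis .
qed

lemma card_chain_images_le: "card (chain_images t m N) \<le> card (lattice_copies m N)"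
  unfolding chain_images_eq by (rule card_image_le[OF finite_lattice_copies])

lemma finite_chain_images: "finite (chain_images t m N)"
  unfolding chain_images_eq by (intro finite_imageI finite_lattice_copies)

subsection \<open>The random colouring\<close>

text \<open>The union bound, by counting: a uniformly random function maps \<open>F\<close> into
  \<open>Q\<close> with probability \<open>(card Q / card P) ^ card F\<close>. If every function met
  a bad event, these probabilities would add up to at least one.\<close>

lemma exists_function_avoiding:
  fixes T :: "'a set" and P :: "'b set" and \<J> :: "('a set \<times> 'b set) set"
  assumes "finite T" "finite P" "P \<noteq> {}" "finite \<J>"
    and sub: "\<And>F Q. (F, Q) \<in> \<J> \<Longrightarrow> F \<subseteq> T \<and> Q \<subseteq> P"
    and lt1: "(\<Sum>(F, Q)\<in>\<J>. (real (card Q) / real (card P)) ^ card F) < 1"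
  shows "\<exists>c\<in>T \<rightarrow> P. \<forall>(F, Q)\<in>\<J>. \<not> c ` F \<subseteq> Q"
proof (rule ccontr)
  assume neg: "\<not> ?thesis"
  define \<Omega> where "\<Omega> = T \<rightarrow>\<^sub>E P"
  \<comment> \<open>A bad event is again a product of sets, with factor \<open>Q\<close> over
    \<open>F\<close> and factor \<open>P\<close> elsewhere, so its size is a product.\<close>
  define bad where "bad = (\<lambda>(F, Q). Pi\<^sub>E T (\<lambda>a. if a \<in> F then Q else P))"
  have p: "real (card P) > 0" using assms(2,3) by (simp add: card_gt_0_iff)
  have \<Omega>: "card \<Omega> = card P ^ card T" unfolding \<Omega>_def using assms(1) by (simp add: card_PiE)
  have card_bad: "real (card (bad (F, Q))) = real (card \<Omega>) * (real (card Q) / real (card P)) ^ card F"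
    if FQ: "(F, Q) \<in> \<J>" for F Q
  proof -
    have F: "F \<subseteq> T" "Q \<subseteq> P" "finite F" using sub[OF FQ] assms(1) by (auto intro: finite_subset)
    have "card (bad (F, Q)) = (\<Prod>a\<in>T. if a \<in> F then card Q else card P)"
      unfolding bad_def using assms(1) by (auto simp: card_PiE intro!: prod.cong)
    also have "\<dots> = card Q ^ card F * card P ^ (card T - card F)"
      using assms(1) F by (simp add: prod.If_cases Int_absorb1 Diff_eq[symmetric] card_Diff_subset)
    finally have "real (card (bad (F, Q))) = real (card Q) ^ card F * real (card P) ^ (card T - card F)"
      by simp
    moreover have "card F \<le> card T" using F assms(1) by (intro card_mono)
    ultimately show ?thesis using p unfolding \<Omega> by (simp add: power_divide power_diff)
  qed
  have "\<Omega> \<subseteq> (\<Union>j\<in>\<J>. bad j)"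
  proof
    fix c assume c: "c \<in> \<Omega>"
    then have "c \<in> T \<rightarrow> P" unfolding \<Omega>_def by auto
    then obtain F Q where FQ: "(F, Q) \<in> \<J>" "c ` F \<subseteq> Q" using neg by blast
    have "c \<in> bad (F, Q)" using c FQ(2) unfolding \<Omega>_def bad_def by (auto simp: PiE_iff)
    then show "c \<in> (\<Union>j\<in>\<J>. bad j)" using FQ(1) by blast
  qed
  moreover have "finite (bad j)" if "j \<in> \<J>" for j
  proof -
    obtain F Q where j: "j = (F, Q)" by (cases j)
    then have "finite Q" using that sub assms(2) by (meson finite_subset)
    then show ?thesis using assms(1,2) unfolding j bad_def by (auto intro!: finite_PiE)
  qed
  ultimately have "card \<Omega> \<le> card (\<Union>j\<in>\<J>. bad j)"
    using assms(4) by (intro card_mono) auto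
  also have "\<dots> \<le> (\<Sum>j\<in>\<J>. card (bad j))" using assms(4) by (rule card_UN_le)
  finally have "real (card \<Omega>) \<le> (\<Sum>j\<in>\<J>. real (card (bad j)))"
    by (metis of_nat_le_iff of_nat_sum)
  also have "\<dots> = (\<Sum>(F, Q)\<in>\<J>. real (card \<Omega>) * (real (card Q) / real (card P)) ^ card F)"
    by (intro sum.cong) (auto simp: card_bad)
  also have "\<dots> = real (card \<Omega>) * (\<Sum>(F, Q)\<in>\<J>. (real (card Q) / real (card P)) ^ card F)"
    by (simp add: sum_distrib_left case_prod_unfold)
  also have "\<dots> < real (card \<Omega>)" using lt1 p \<Omega> by simp
  finally show False by simp
qed

lemma t_chains_mono: "m \<le> n \<Longrightarrow> t_chains t m \<subseteq> t_chains t n"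
  unfolding t_chains_def subset_chain_def boolean_lattice_def by fastforce

lemma strong_embedding_restrict:
  assumes "strong_embedding n N f" "m \<le> n"
  shows "strong_embedding m N f"
proof -
  have "boolean_lattice m \<subseteq> boolean_lattice n"
    using assms(2) unfolding boolean_lattice_def by auto
  then show ?thesis
    using assms(1) unfolding strong_embedding_def by (blast intro: inj_on_subset)
qed

text \<open>The summands are the expected numbers of monochromatic copies of B_(m 1) in the
  \<open>K\<close> colours of probability \<open>1 / (2 * real K)\<close> and of B_(m k) in the
  colour of probability 1/2.\<close>

lemma not_ramsey_property_if_card_copies:
  fixes k t N :: nat and m :: "nat \<Rightarrow> nat"
  defines "K \<equiv> k - 1"
  assumes k: "k \<ge> 2" and m: "\<And>i. 1 \<le> i \<Longrightarrow> i \<le> k \<Longrightarrow> m 1 \<le> m i"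
    and lt1: "real K * real (card (lattice_copies (m 1) N)) * (1 / (2 * real K)) ^ num_chains t (m 1)
      + real (card (lattice_copies (m k) N)) * (1 / 2) ^ num_chains t (m k) < 1"
  shows "\<not> ramsey_property k t m N"
proof
  assume ramsey: "ramsey_property k t m N"
  \<comment> \<open>Uniform colouring from a palette of \<open>2K\<close> shades: the last \<open>K\<close> shades
    all stand for colour \<open>k\<close>, each other shade for one of the remaining colours.\<close>
  define \<J>\<^sub>1 where "\<J>\<^sub>1 = chain_images t (m 1) N \<times> (\<lambda>i. {i}) ` {..<K}"
  define \<J>\<^sub>k where "\<J>\<^sub>k = chain_images t (m k) N \<times> {{K..<2 * K}}"
  define w :: "nat set set set \<times> nat set \<Rightarrow> real"
    where "w = (\<lambda>(F, Q). (real (card Q) / real (card {..<2 * K})) ^ card F)"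
  have K: "K \<ge> 1" using k unfolding K_def by simp
  have fin: "finite \<J>\<^sub>1" "finite \<J>\<^sub>k"
    unfolding \<J>\<^sub>1_def \<J>\<^sub>k_def by (intro finite_cartesian_product finite_chain_images finite_imageI; simp)+
  have cardF: "card F = num_chains t n" "F \<subseteq> t_chains t N" if "F \<in> chain_images t n N" for F n
    using that card_image_t_chains image_t_chains_subset unfolding chain_images_def by blast+
  have "sum w \<J>\<^sub>1 = (\<Sum>j\<in>\<J>\<^sub>1. (1 / (2 * real K)) ^ num_chains t (m 1))"
    unfolding w_def \<J>\<^sub>1_def by (intro sum.cong) (auto simp: cardF)
  also have "\<dots> = real (card \<J>\<^sub>1) * (1 / (2 * real K)) ^ num_chains t (m 1)" by simp
  also have "card \<J>\<^sub>1 = K * card (chain_images t (m 1) N)"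
    unfolding \<J>\<^sub>1_def by (simp add: card_cartesian_product card_image)
  finally have 1: "sum w \<J>\<^sub>1 \<le> real K * real (card (lattice_copies (m 1) N)) * (1 / (2 * real K)) ^ num_chains t (m 1)"
    using card_chain_images_le[of t "m 1" N] by (auto intro!: mult_right_mono mult_left_mono)
  have "sum w \<J>\<^sub>k = (\<Sum>j\<in>\<J>\<^sub>k. (1 / 2) ^ num_chains t (m k))"
    unfolding w_def \<J>\<^sub>k_def using K by (intro sum.cong) (auto simp: cardF)
  also have "\<dots> = real (card (chain_images t (m k) N)) * (1 / 2) ^ num_chains t (m k)"
    unfolding \<J>\<^sub>k_def by (simp add: card_cartesian_product)
  finally have 2: "sum w \<J>\<^sub>k \<le> real (card (lattice_copies (m k) N)) * (1 / 2) ^ num_chains t (m k)"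
    using card_chain_images_le[of t "m k" N] by (auto intro!: mult_right_mono mult_left_mono)
  have "sum w (\<J>\<^sub>1 \<union> \<J>\<^sub>k) \<le> sum w \<J>\<^sub>1 + sum w \<J>\<^sub>k"
    using sum.union_inter[OF fin, of w] sum_nonneg[of "\<J>\<^sub>1 \<inter> \<J>\<^sub>k" w]
    by (auto simp: w_def)
  then have "sum w (\<J>\<^sub>1 \<union> \<J>\<^sub>k) < 1" using 1 2 lt1 by linarith
  moreover have "F \<subseteq> t_chains t N \<and> Q \<subseteq> {..<2 * K}" if "(F, Q) \<in> \<J>\<^sub>1 \<union> \<J>\<^sub>k" for F Q
    using that cardF(2) unfolding \<J>\<^sub>1_def \<J>\<^sub>k_def by auto
  ultimately have "\<exists>c\<in>t_chains t N \<rightarrow> {..<2 * K}. \<forall>(F, Q)\<in>\<J>\<^sub>1 \<union> \<J>\<^sub>k. \<not> c ` F \<subseteq> Q"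
    using fin finite_t_chains K unfolding w_def
    by (intro exists_function_avoiding) (auto simp: lessThan_empty_iff)
  then obtain c where c: "c \<in> t_chains t N \<rightarrow> {..<2 * K}"
      and all: "\<forall>(F, Q)\<in>\<J>\<^sub>1 \<union> \<J>\<^sub>k. \<not> c ` F \<subseteq> Q" by (elim bexE)
  have avoid: "\<not> c ` F \<subseteq> Q" if "(F, Q) \<in> \<J>\<^sub>1 \<union> \<J>\<^sub>k" for F Q
    using bspec[OF all that] by simp
  \<comment> \<open>Shades count from 0 and colours from 1, so shade \<open>i - 1\<close> becomes
    colour \<open>i\<close>; the shades from \<open>K\<close> on merge into colour
    \<open>k\<close>.\<close>
  define c' where "c' A = (if c A < K then Suc (c A) else k)" for A
  have "c' \<in> t_chains t N \<rightarrow> {1..k}" using k unfolding c'_def K_def by auto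
  then obtain i f where i: "i \<in> {1..k}" and "mono_induced_copy t N c' i (m i) f"
    using ramsey unfolding ramsey_property_def by blast
  then have f: "strong_embedding (m i) N f" "\<And>A. A \<in> t_chains t (m i) \<Longrightarrow> c' (f ` A) = i"
    unfolding mono_induced_copy_def by blast+
  show False
  proof (cases "i = k")
    case True
    have "((`) f ` t_chains t (m k), {K..<2 * K}) \<in> \<J>\<^sub>k"
      using f(1) True unfolding \<J>\<^sub>k_def chain_images_def by blast
    then have "\<not> c ` ((`) f ` t_chains t (m k)) \<subseteq> {K..<2 * K}" by (intro avoid) simp
    moreover have "c (f ` A) \<in> {K..<2 * K}" if "A \<in> t_chains t (m k)" for A
    proof -
      have "f ` A \<in> t_chains t N" using image_t_chains_subset[OF f(1)] that True by blast
      then have "c (f ` A) < 2 * K" using c by blast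
      moreover have "\<not> c (f ` A) < K" using f(2)[of A] that True unfolding c'_def K_def by auto
      ultimately show ?thesis by simp
    qed
    ultimately show False by blast
  next
    case False
    have m1: "m 1 \<le> m i" using m i by simp
    \<comment> \<open>The restriction of \<open>f\<close> to the smaller lattice is a copy of B_(m
      1) in the same colour.\<close>
    have "((`) f ` t_chains t (m 1), {i - 1}) \<in> \<J>\<^sub>1"
      using strong_embedding_restrict[OF f(1) m1] i False
      unfolding \<J>\<^sub>1_def chain_images_def K_def by auto
    then have "\<not> c ` ((`) f ` t_chains t (m 1)) \<subseteq> {i - 1}" by (intro avoid) simp
    moreover have "c (f ` A) = i - 1" if "A \<in> t_chains t (m 1)" for A
    proof -
      have "c' (f ` A) = i" using f(2) that t_chains_mono[OF m1, of t] by blast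
      then show ?thesis using False unfolding c'_def by (auto split: if_splits)
    qed
    ultimately show False by blast
  qed
qed

section \<open>Small chain counts and degenerate cases\<close>

lemma initial_segments_in_t_chains:
  assumes "a \<in> {1, 2}" "a \<le> m" "t - 1 \<le> m"
  shows "(\<lambda>i. if i = 1 then {a} else {1..i}) ` {..<t} \<in> t_chains t m"
proof -
  \<comment> \<open>The chain is {}, {a}, {1,2}, {1,2,3}, and so on; for both choices of
    \<open>a\<close> the singleton fits between its neighbours. The set at place \<open>i\<close>
    has \<open>i\<close> elements, so \<open>card\<close> inverts the enumeration.\<close>
  let ?g = "\<lambda>i::nat. if i = 1 then {a} else {1..i}"
  have "inj_on ?g {..<t}" by (rule inj_on_inverseI[of _ card]) simp
  then have "card (?g ` {..<t}) = t" by (metis card_image card_lessThan)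
  moreover have mono: "?g i \<subseteq> ?g j" if "i \<le> j" for i j
    using that assms(1) by auto
  have "\<forall>x\<in>?g ` {..<t}. \<forall>y\<in>?g ` {..<t}. x \<subseteq> y \<or> y \<subseteq> x"
  proof (intro ballI)
    fix x y assume "x \<in> ?g ` {..<t}" "y \<in> ?g ` {..<t}"
    then obtain i j where "x = ?g i" "y = ?g j" by blast
    then show "x \<subseteq> y \<or> y \<subseteq> x" using mono[of i j] mono[of j i] nle_le[of i j] by blast
  qed
  moreover have "?g ` {..<t} \<subseteq> boolean_lattice m"
    using assms unfolding boolean_lattice_def by auto
  ultimately show ?thesis unfolding t_chains_def subset_chain_def by blast
qed

text \<open>The chains of initial segments through {1} and through {2} differ. The bound makes the
  exponents h - 1 of the final estimate positive.\<close>

lemma num_chains_ge_2: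
  assumes "2 \<le> t" "t - 1 \<le> m" "2 \<le> m"
  shows "2 \<le> num_chains t m"
proof -
  define A where "A a = (\<lambda>i::nat. if i = 1 then {a::nat} else {1..i}) ` {..<t}" for a
  have sub: "{A 1, A 2} \<subseteq> t_chains t m"
    using initial_segments_in_t_chains[of 1 m t] initial_segments_in_t_chains[of 2 m t] assms
    unfolding A_def by simp
  have "{1} \<in> A 1" unfolding A_def using assms(1) by (intro image_eqI[of _ _ 1]) auto
  moreover have "{1} \<notin> A 2"
  proof
    assume "{1} \<in> A 2"
    then obtain i where i: "{1} = (if i = 1 then {2::nat} else {1..i})" unfolding A_def by blast
    have "card (if i = 1 then {2::nat} else {1..i}) = i" by simp
    then have "i = 1" unfolding i[symmetric] by simp
    then show False using i by simp
  qed
  ultimately have "card {A 1, A 2} = 2" by (metis card_2_iff)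
  then show ?thesis unfolding num_chains_def using card_mono[OF finite_t_chains sub] by simp
qed

text \<open>Serves the case \<open>m 1 = 1\<close>, which forces \<open>t = 2\<close>: the first
  term of the minimum is then at most 1.\<close>

lemma num_chains_2_1: "num_chains 2 1 \<le> 1"
proof -
  have "t_chains 2 1 \<subseteq> {Pow {1}}"
  proof
    fix A assume A: "A \<in> t_chains 2 1"
    have "A = Pow {1}"
    proof (rule card_subset_eq)
      show "A \<subseteq> Pow {1}" using A unfolding t_chains_def subset_chain_def boolean_lattice_def by simp
      show "card A = card (Pow {1::nat})" using A unfolding t_chains_def by (simp add: card_Pow)
    qed simp
    then show "A \<in> {Pow {1}}" by simp
  qed
  from card_mono[OF _ this] show ?thesis unfolding num_chains_def by simp
qed

text \<open>In \<open>enat\<close> the infimum of the empty set is infinite, and that of any other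
  set is attained.\<close>

lemma less_boolean_ramsey:
  assumes "\<And>N. ramsey_property k t m N \<Longrightarrow> x < real N"
  shows "ereal x < ereal_of_enat (boolean_ramsey k t m)"
proof (cases "{N. ramsey_property k t m N} = {}")
  case True
  then show ?thesis unfolding boolean_ramsey_def by (simp add: Inf_enat_def)
next
  case False
  then have "boolean_ramsey k t m \<in> enat ` {N. ramsey_property k t m N}"
    unfolding boolean_ramsey_def Inf_enat_def by (auto intro: LeastI)
  then show ?thesis using assms by auto
qed

text \<open>Colour everything with \<open>k\<close>. Each B_(m i) has a t-chain, so no copy is
  monochromatic vacuously and only colour \<open>k\<close> remains; but B_(m k) does not fit into
  B_N.\<close>

lemma not_ramsey_property_if_less:
  assumes "1 \<le> k" "\<And>i. 1 \<le> i \<Longrightarrow> i \<le> k \<Longrightarrow> 1 \<le> m i \<and> t - 1 \<le> m i" "N < m k"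
  shows "\<not> ramsey_property k t m N"
proof
  assume "ramsey_property k t m N"
  moreover have "(\<lambda>A. k) \<in> t_chains t N \<rightarrow> {1..k}" using assms(1) by simp
  ultimately obtain i f where i: "i \<in> {1..k}" "mono_induced_copy t N (\<lambda>A. k) i (m i) f"
    unfolding ramsey_property_def by blast
  then have f: "strong_embedding (m i) N f" "A \<in> t_chains t (m i) \<Longrightarrow> k = i" for A
    unfolding mono_induced_copy_def by blast+
  have "k = i"
    using f(2)[OF initial_segments_in_t_chains[of 1 "m i" t]] assms(2)[of i] i(1) by auto
  then show False using strong_embedding_le[OF f(1)] assms(3) by simp
qed

subsection \<open>Numerical estimates\<close>

text \<open>
  Up to a factor of 2, the bound for colour \<open>k\<close>: the hypothesis on \<open>N - m\<close> yields
  \<open>4 ^ (b * (N - m)) \<le> 2 ^ (h - 1)\<close>.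
\<close>

definition copies_ratio :: "nat \<Rightarrow> nat \<Rightarrow> real" where
  "copies_ratio m d = real ((m + d) choose m) * (3 / 4) ^ ((m choose (m div 2)) * d)"

text \<open>Consecutive binomials have the ratio (m + d + 1) / (d + 1), so the first hypothesis says
  that the sequence does not grow at \<open>d\<close>.\<close>

lemma binomial_step_le:
  assumes "real (m + d + 1) * q \<le> real (d + 1)" "0 \<le> q"
  shows "real ((m + Suc d) choose m) * q ^ Suc d \<le> real ((m + d) choose m) * q ^ d"
proof -
  have "(Suc (m + d) - m) * (Suc (m + d) choose m) = Suc (m + d) * ((m + d) choose m)"
    using binomial_absorb_comp[of "Suc (m + d)" m] by simp
  then have "Suc d * ((m + Suc d) choose m) = (m + d + 1) * ((m + d) choose m)" by simp
  then have eq: "real (d + 1) * real ((m + Suc d) choose m) = real (m + d + 1) * real ((m + d) choose m)"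
    by (metis Suc_eq_plus1 of_nat_mult)
  have "real (d + 1) * (real ((m + Suc d) choose m) * q ^ Suc d)
      = (real (m + d + 1) * q) * (real ((m + d) choose m) * q ^ d)"
    using arg_cong[OF eq, of "\<lambda>x. x * q ^ Suc d"] by (simp only: power_Suc mult_ac)
  also have "\<dots> \<le> real (d + 1) * (real ((m + d) choose m) * q ^ d)"
    using assms by (intro mult_right_mono) auto
  finally show ?thesis by (simp del: power_Suc)
qed

text \<open>Each step multiplies the binomial by (m + d + 1) / (d + 1), which is at most m +
  1.\<close>

lemma binomial_add_le_power: "(m + d) choose m \<le> (m + 1) ^ d"
proof (induction d)
  case (Suc d)
  have "Suc d * ((m + Suc d) choose m) = (m + d + 1) * ((m + d) choose m)"
    using binomial_absorb_comp[of "Suc (m + d)" m] by simp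
  also have "\<dots> \<le> (Suc d * (m + 1)) * ((m + d) choose m)" by (intro mult_right_mono) auto
  also have "\<dots> \<le> (Suc d * (m + 1)) * (m + 1) ^ d" using Suc by (rule mult_left_mono) simp
  also have "\<dots> = Suc d * (m + 1) ^ Suc d" by (simp only: power_Suc mult_ac)
  finally show ?case by (simp only: mult_le_cancel1)
qed simp

lemma central_binomial_ge:
  assumes "2 \<le> m"
  shows "m * (m - 1) div 2 \<le> m choose (m div 2)"
  using binomial_maximum[of m 2] by (simp add: choose_two)

lemma central_binomial_ge_2: "2 \<le> m \<Longrightarrow> 2 \<le> m choose (m div 2)"
proof (cases "m = 2")
  case False
  assume "2 \<le> m"
  then have "3 * 2 div 2 \<le> m * (m - 1) div 2" using False by (intro div_le_mono mult_le_mono) auto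
  then show ?thesis using central_binomial_ge[OF \<open>2 \<le> m\<close>] by simp
qed simp

text \<open>The exponent m + 2 is a lower bound of the central binomial from m = 4 on, with equality
  at 4. Passing to m + 1 multiplies the left side by 3 (m + 2) / (4 (m + 1)), which is below
  one.\<close>

lemma power_bound_4: "4 \<le> m \<Longrightarrow> real (m + 1) * (3 / 4) ^ (m + 2) \<le> 1"
proof (induction m rule: dec_induct)
  case (step m)
  have "real (Suc m + 1) * (3 / 4) ^ (Suc m + 2) = (real (m + 2) * (3 / 4)) * (3 / 4) ^ (m + 2)"
    by simp
  also have "\<dots> \<le> real (m + 1) * (3 / 4) ^ (m + 2)" using step by (intro mult_right_mono) auto
  finally show ?case using step by linarith
qed (simp add: power_numeral_even power_numeral_odd field_simps)

text \<open>With b the central binomial, the ratio is at most the d-th power of (m + 1) (3/4)^b.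
  This base is at most one from m = 4 on; for m = 2 and m = 3 it is 27/16, so these are treated
  apart.\<close>

lemma copies_ratio_le_1:
  assumes "4 \<le> m"
  shows "copies_ratio m d \<le> 1"
proof -
  have "(m + 2) * 2 \<le> m * (m - 1)"
  proof -
    obtain n where "m = n + 4" using assms by (metis add.commute le_Suc_ex)
    then show ?thesis by (simp add: algebra_simps)
  qed
  then have "m + 2 \<le> m * (m - 1) div 2" by simp
  also have "\<dots> \<le> m choose (m div 2)" using assms by (intro central_binomial_ge) simp
  finally have "m + 2 \<le> m choose (m div 2)" .
  then have "real (m + 1) * (3 / 4) ^ (m choose (m div 2)) \<le> real (m + 1) * (3 / 4) ^ (m + 2)"
    by (intro mult_left_mono power_decreasing) auto
  also have "\<dots> \<le> 1" using power_bound_4[OF assms] .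
  finally have *: "real (m + 1) * (3 / 4) ^ (m choose (m div 2)) \<le> 1" .
  have "copies_ratio m d \<le> real ((m + 1) ^ d) * (3 / 4) ^ ((m choose (m div 2)) * d)"
    unfolding copies_ratio_def using binomial_add_le_power[of m d]
    by (intro mult_right_mono) (simp_all del: of_nat_power)
  also have "\<dots> = (real (m + 1) * (3 / 4) ^ (m choose (m div 2))) ^ d"
    by (simp add: power_mult power_mult_distrib)
  also have "\<dots> \<le> 1" using * by (intro power_le_one) auto
  finally show ?thesis .
qed

text \<open>Here \<open>q\<close> is (3/4)^b for the central binomials b = 2 and b = 3.\<close>

lemma copies_ratio_small:
  assumes "m = 2 \<and> q = (9 / 16 :: real) \<or> m = 3 \<and> q = 27 / 64"
  shows "copies_ratio m d = real ((m + d) choose m) * q ^ d"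
proof -
  have "q = (3 / 4) ^ (m choose (m div 2))"
    using assms by (elim disjE conjE; hypsubst; simp add: power2_eq_square power3_eq_cube)
  then show ?thesis unfolding copies_ratio_def by (simp add: power_mult)
qed

text \<open>The constant is attained twice: 3 times 9/16 for m = 2 and 4 times 27/64 for m =
  3.\<close>

lemma copies_ratio_1_le:
  assumes "2 \<le> m"
  shows "copies_ratio m 1 \<le> 27 / 16"
proof -
  consider "m = 2" | "m = 3" | "4 \<le> m" using assms by linarith
  then show ?thesis
  proof cases
    case 1
    then show ?thesis using copies_ratio_small[of m "9/16" 1] by (simp add: choose_two)
  next
    case 2
    then show ?thesis using copies_ratio_small[of m "27/64" 1] by (simp add: numeral_eq_Suc)
  next
    case 3
    then show ?thesis using copies_ratio_le_1[of m 1] by simp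
  qed
qed

text \<open>For m = 2 and m = 3 the values do not increase from d = 2 on, and 243/128 is 6 times
  (9/16)^2, the value at m = d = 2. It is crucial that it stays below 2, the total available in the
  final estimate.\<close>

lemma copies_ratio_le:
  assumes "2 \<le> m"
  shows "copies_ratio m d \<le> 243 / 128"
proof -
  have small: "copies_ratio m d \<le> 243 / 128"
    if mq: "m = 2 \<and> q = (9 / 16 :: real) \<or> m = 3 \<and> q = 27 / 64" for q
  proof -
    consider "d = 0" | "d = 1" | "2 \<le> d" by linarith
    then show ?thesis
    proof cases
      case 1
      then show ?thesis unfolding copies_ratio_def by simp
    next
      case 2
      then show ?thesis using copies_ratio_1_le[OF assms] by simp
    next
      case 3
      then have "copies_ratio m d \<le> copies_ratio m 2"
      proof (induction d rule: dec_induct)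
        case (step e)
        have "copies_ratio m (Suc e) \<le> copies_ratio m e"
          unfolding copies_ratio_small[OF mq]
          by (rule binomial_step_le; insert mq step.hyps; elim disjE conjE; hypsubst; simp)
        then show ?case using step by linarith
      qed simp
      also have "copies_ratio m 2 \<le> 243 / 128"
      proof -
        have "(4 choose 2 :: nat) = 6" "(5 choose 3 :: nat) = 10" by (simp_all add: numeral_eq_Suc)
        then show ?thesis
          unfolding copies_ratio_small[OF mq] using mq
          by (elim disjE conjE; hypsubst; simp add: power2_eq_square)
      qed
      finally show ?thesis .
    qed
  qed
  consider "m = 2" | "m = 3" | "4 \<le> m" using assms by linarith
  then show ?thesis
  proof cases
    case 1
    then show ?thesis by (intro small[of "9 / 16"]) simp
  next
    case 2
    then show ?thesis by (intro small[of "27 / 64"]) simp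
  next
    case 3
    then show ?thesis using copies_ratio_le_1[of m d] by linarith
  qed
qed

section \<open>The expected number of forbidden copies\<close>

lemma card_lattice_copies_le_copies_ratio:
  assumes "m \<le> N"
  shows "real (card (lattice_copies m N))
    \<le> copies_ratio m (N - m) * 4 ^ ((m choose (m div 2)) * (N - m))"
proof -
  have "real (card (lattice_copies m N)) \<le> real (N choose m) * 3 ^ ((m choose (m div 2)) * (N - m))"
    using of_nat_mono[OF card_lattice_copies_le[of m N], where 'a = real] by (simp add: power_mult)
  also have "\<dots> = copies_ratio m (N - m) * 4 ^ ((m choose (m div 2)) * (N - m))"
    using assms unfolding copies_ratio_def by (simp add: power_divide)
  finally show ?thesis .
qed


text \<open>The doubled expectation has to stay below 2. The contribution of colour \<open>k\<close>
  is at most a value of \<open>copies_ratio\<close>, hence at most 243/128. The factor 4 in the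
  denominator of \<open>N1\<close> makes the other contribution small enough to fit into the
  remaining gap.\<close>

lemma not_ramsey_property_large:
  fixes k t N :: nat and m :: "nat \<Rightarrow> nat"
  assumes k: "3 \<le> k" and t: "2 \<le> t" "t - 1 \<le> m 1"
    and m: "\<And>i. 1 \<le> i \<Longrightarrow> i \<le> k \<Longrightarrow> m 1 \<le> m i" and m1: "2 \<le> m 1" and N: "m k \<le> N"
    and N1: "real N \<le> real (m 1) +
        (real (num_chains t (m 1)) + (real (num_chains t (m 1)) - 1) * log 2 (real k - 1) - 1)
          / (4 * real (m 1 choose (m 1 div 2)))"
    and Nk: "real N \<le> real (m k) +
        (real (num_chains t (m k)) - 1) / (2 * real (m k choose (m k div 2)))"
  shows "\<not> ramsey_property k t m N"
proof -
  define K h\<^sub>1 h\<^sub>k b\<^sub>1 b\<^sub>k d\<^sub>1 d\<^sub>k where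
    "K = k - 1" and "h\<^sub>1 = num_chains t (m 1)" and "h\<^sub>k = num_chains t (m k)"
    and "b\<^sub>1 = (m 1 choose (m 1 div 2))" and "b\<^sub>k = (m k choose (m k div 2))"
    and "d\<^sub>1 = N - m 1" and "d\<^sub>k = N - m k"
  have m1k: "m 1 \<le> m k" using m k by simp
  have h: "2 \<le> h\<^sub>1" "2 \<le> h\<^sub>k"
    unfolding h\<^sub>1_def h\<^sub>k_def using t m1 m1k by (auto intro!: num_chains_ge_2)
  have b: "2 \<le> b\<^sub>1" "2 \<le> b\<^sub>k"
    unfolding b\<^sub>1_def b\<^sub>k_def using m1 m1k by (auto intro!: central_binomial_ge_2)
  have K: "2 \<le> K" "real k - 1 = real K" using k unfolding K_def by auto
  have d: "real d\<^sub>1 = real N - real (m 1)" "real d\<^sub>k = real N - real (m k)" "d\<^sub>k \<le> d\<^sub>1"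
    using N m1k unfolding d\<^sub>1_def d\<^sub>k_def by auto
  define C\<^sub>1 C\<^sub>k where "C\<^sub>1 = real (card (lattice_copies (m 1) N))" and "C\<^sub>k = real (card (lattice_copies (m k) N))"
  have C1: "C\<^sub>1 \<le> copies_ratio (m 1) d\<^sub>1 * 4 ^ (b\<^sub>1 * d\<^sub>1)"
    unfolding C\<^sub>1_def b\<^sub>1_def d\<^sub>1_def using N m1k by (intro card_lattice_copies_le_copies_ratio) simp
  have Ck: "C\<^sub>k \<le> copies_ratio (m k) d\<^sub>k * 4 ^ (b\<^sub>k * d\<^sub>k)"
    unfolding C\<^sub>k_def b\<^sub>k_def d\<^sub>k_def using N by (intro card_lattice_copies_le_copies_ratio)
  \<comment> \<open>Doubling cancels one factor 1/2 for colour \<open>k\<close>. For the other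
    colours it also uses up the factor \<open>K\<close>, the number of these colours.\<close>
  have split: "2 * (K * C\<^sub>1 * (1 / (2 * real K)) ^ h\<^sub>1) = C\<^sub>1 / (2 * real K) ^ (h\<^sub>1 - 1)"
    "2 * (C\<^sub>k * (1 / 2) ^ h\<^sub>k) = C\<^sub>k / 2 ^ (h\<^sub>k - 1)"
  proof -
    obtain a where a: "h\<^sub>1 = Suc a" using h(1) by (cases h\<^sub>1) auto
    show "2 * (K * C\<^sub>1 * (1 / (2 * real K)) ^ h\<^sub>1) = C\<^sub>1 / (2 * real K) ^ (h\<^sub>1 - 1)"
      using K unfolding a by (simp add: power_divide)
    obtain a where a: "h\<^sub>k = Suc a" using h(2) by (cases h\<^sub>k) auto
    show "2 * (C\<^sub>k * (1 / 2) ^ h\<^sub>k) = C\<^sub>k / 2 ^ (h\<^sub>k - 1)"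
      unfolding a by (simp add: power_divide)
  qed
  have "C\<^sub>1 / (2 * real K) ^ (h\<^sub>1 - 1) + C\<^sub>k / 2 ^ (h\<^sub>k - 1) < 2"
  proof (cases "d\<^sub>1 = 0")
    \<comment> \<open>With no spare coordinates there is just one copy and no small power of 1/4;
      the bounds on the chain counts give 1/4 + 1/2 instead.\<close>
    case True
    then have "C\<^sub>1 \<le> 1" "C\<^sub>k \<le> 1" using C1 Ck d(3) unfolding copies_ratio_def by simp_all
    moreover have "(2::real) ^ 1 \<le> 2 ^ (h\<^sub>k - 1)" using h by (intro power_increasing) auto
    moreover have "(4::real) ^ 1 \<le> (2 * real K) ^ 1" using K by simp
    moreover have "\<dots> \<le> (2 * real K) ^ (h\<^sub>1 - 1)" using h K by (intro power_increasing) auto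
    ultimately have "C\<^sub>1 / (2 * real K) ^ (h\<^sub>1 - 1) \<le> 1 / 4" "C\<^sub>k / 2 ^ (h\<^sub>k - 1) \<le> 1 / 2"
      by (auto intro!: frac_le)
    then show ?thesis by linarith
  next
    case False
    have "real (4 * (b\<^sub>1 * d\<^sub>1)) \<le> real (h\<^sub>1 - 1) * log 2 (2 * real K)"
    proof -
      have "real d\<^sub>1 \<le> (real h\<^sub>1 + (real h\<^sub>1 - 1) * log 2 (real K) - 1) / (4 * real b\<^sub>1)"
        using N1 d(1) K(2) unfolding h\<^sub>1_def b\<^sub>1_def by simp
      then have "4 * real b\<^sub>1 * real d\<^sub>1 \<le> real h\<^sub>1 + (real h\<^sub>1 - 1) * log 2 (real K) - 1"
        using b by (simp add: field_simps)
      \<comment> \<open>The numerator equals (h - 1) (1 + log K), and the 1 turns log K into log (2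
        K).\<close>
      also have "\<dots> = real (h\<^sub>1 - 1) * log 2 (2 * real K)"
        using h K by (simp add: log_mult algebra_simps of_nat_diff)
      finally show ?thesis by simp
    qed
    then have "2 powr real (4 * (b\<^sub>1 * d\<^sub>1)) \<le> 2 powr (real (h\<^sub>1 - 1) * log 2 (2 * real K))"
      by (intro powr_mono) auto
    also have "\<dots> = (2 * real K) ^ (h\<^sub>1 - 1)"
    proof -
      have "2 powr (real (h\<^sub>1 - 1) * log 2 (2 * real K)) = (2 powr log 2 (2 * real K)) powr real (h\<^sub>1 - 1)"
        by (simp only: powr_powr mult.commute)
      also have "2 powr log 2 (2 * real K) = 2 * real K" using K by (intro powr_log_cancel) auto
      also have "\<dots> powr real (h\<^sub>1 - 1) = \<dots> ^ (h\<^sub>1 - 1)" using K by (intro powr_realpow) simp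
      finally show ?thesis .
    qed
    \<comment> \<open>The number of copies is about \<open>4 ^ (b\<^sub>1 * d\<^sub>1)\<close>, so
      the base 16 leaves a spare factor \<open>(1 / 4) ^ (b\<^sub>1 * d\<^sub>1)\<close>.\<close>
    finally have pow1: "16 ^ (b\<^sub>1 * d\<^sub>1) \<le> (2 * real K) ^ (h\<^sub>1 - 1)"
      by (simp add: powr_realpow power_mult del: of_nat_mult)
    have "real d\<^sub>k \<le> (real h\<^sub>k - 1) / (2 * real b\<^sub>k)"
      using Nk d(2) unfolding h\<^sub>k_def b\<^sub>k_def by simp
    then have "2 * real b\<^sub>k * real d\<^sub>k \<le> real h\<^sub>k - 1" using b by (simp add: field_simps)
    then have "real (2 * (b\<^sub>k * d\<^sub>k)) \<le> real (h\<^sub>k - 1)" using h by (simp add: of_nat_diff)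
    then have "2 * (b\<^sub>k * d\<^sub>k) \<le> h\<^sub>k - 1" by (simp only: of_nat_le_iff)
    then have "(2::real) ^ (2 * (b\<^sub>k * d\<^sub>k)) \<le> 2 ^ (h\<^sub>k - 1)" by (intro power_increasing) auto
    then have powk: "(4::real) ^ (b\<^sub>k * d\<^sub>k) \<le> 2 ^ (h\<^sub>k - 1)" by (simp add: power_mult)
    have nonneg: "0 \<le> copies_ratio n e" for n e unfolding copies_ratio_def by simp
    have "C\<^sub>k / 2 ^ (h\<^sub>k - 1) \<le> copies_ratio (m k) d\<^sub>k * 4 ^ (b\<^sub>k * d\<^sub>k) / 4 ^ (b\<^sub>k * d\<^sub>k)"
      using Ck powk nonneg by (intro frac_le) auto
    then have rk: "C\<^sub>k / 2 ^ (h\<^sub>k - 1) \<le> copies_ratio (m k) d\<^sub>k" by simp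
    have "C\<^sub>1 / (2 * real K) ^ (h\<^sub>1 - 1) \<le> copies_ratio (m 1) d\<^sub>1 * 4 ^ (b\<^sub>1 * d\<^sub>1) / 16 ^ (b\<^sub>1 * d\<^sub>1)"
      using C1 pow1 nonneg by (intro frac_le) auto
    also have "\<dots> = copies_ratio (m 1) d\<^sub>1 * (1 / 4) ^ (b\<^sub>1 * d\<^sub>1)"
      by (simp flip: power_divide times_divide_eq_right)
    also have "\<dots> \<le> copies_ratio (m 1) d\<^sub>1 * (1 / 4) ^ (2 * d\<^sub>1)"
      using b nonneg by (intro mult_left_mono power_decreasing) auto
    finally have r1: "C\<^sub>1 / (2 * real K) ^ (h\<^sub>1 - 1) \<le> copies_ratio (m 1) d\<^sub>1 * (1 / 4) ^ (2 * d\<^sub>1)" .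
    show ?thesis
    \<comment> \<open>For \<open>d\<^sub>1 = 1\<close> the general bound is too weak: 243/128 +
      27/256 exceeds 2. But then \<open>d\<^sub>k\<close> is at most 1 as well, and 27/16 + 27/256
      is below 2. From \<open>d\<^sub>1 = 2\<close> on the spare factor is at most 1/256.\<close>
    proof (cases "d\<^sub>1 = 1")
      case True
      then have "d\<^sub>k = 0 \<or> d\<^sub>k = 1" using d(3) by auto
      then have "copies_ratio (m k) d\<^sub>k \<le> 27 / 16"
        using copies_ratio_1_le[of "m k"] m1 m1k unfolding copies_ratio_def by auto
      moreover have "copies_ratio (m 1) d\<^sub>1 * (1 / 4) ^ (2 * d\<^sub>1) \<le> 27 / 256"
        using copies_ratio_1_le[OF m1] True by (simp add: power2_eq_square)
      ultimately show ?thesis using rk r1 by linarith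
    next
      case d1: False
      have "(1 / 4) ^ (2 * d\<^sub>1) \<le> (1 / 4 :: real) ^ 4"
        using False d1 by (intro power_decreasing) auto
      then have "copies_ratio (m 1) d\<^sub>1 * (1 / 4) ^ (2 * d\<^sub>1) \<le> (243 / 128) * (1 / 4) ^ 4"
        using copies_ratio_le[OF m1, of d\<^sub>1] nonneg by (intro mult_mono) auto
      moreover have "copies_ratio (m k) d\<^sub>k \<le> 243 / 128"
        using m1 m1k by (intro copies_ratio_le) simp
      ultimately show ?thesis using rk r1 by (simp add: power_numeral_even)
    qed
  qed
  then have "K * C\<^sub>1 * (1 / (2 * real K)) ^ h\<^sub>1 + C\<^sub>k * (1 / 2) ^ h\<^sub>k < 1"
    using split by linarith
  then show ?thesis
    using k m unfolding C\<^sub>1_def C\<^sub>k_def h\<^sub>1_def h\<^sub>k_def K_def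
    by (intro not_ramsey_property_if_card_copies) auto
qed

text \<open>\<open>nondegenerate\<close> excludes a single case: \<open>m k = 1\<close> forces
  \<open>t = 2\<close> and all \<open>m i = 1\<close>. Both terms of the minimum are then 1, and B_1
  with its only 2-chain has the Ramsey property, so the strict inequality fails.\<close>

theorem theorem4p1:
  fixes k t :: nat and m :: "nat \<Rightarrow> nat"
  assumes "k \<ge> 3"
    and "1 \<le> t - 1" and "t - 1 \<le> m 1"
    and "\<And>i j. 1 \<le> i \<Longrightarrow> i \<le> j \<Longrightarrow> j \<le> k \<Longrightarrow> m i \<le> m j"
    and nondegenerate: "m k \<noteq> 1"
  shows "ereal_of_enat (boolean_ramsey k t m) >
    ereal (min
      (real (m 1) +
        (real (num_chains t (m 1)) + (real (num_chains t (m 1)) - 1) * log 2 (real k - 1) - 1)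
          / (4 * real (m 1 choose (m 1 div 2))))
      (real (m k) +
        (real (num_chains t (m k)) - 1) / (2 * real (m k choose (m k div 2)))))"
proof (rule less_boolean_ramsey, rule ccontr)
  fix N assume ramsey: "ramsey_property k t m N"
  assume "\<not> min
      (real (m 1) +
        (real (num_chains t (m 1)) + (real (num_chains t (m 1)) - 1) * log 2 (real k - 1) - 1)
          / (4 * real (m 1 choose (m 1 div 2))))
      (real (m k) +
        (real (num_chains t (m k)) - 1) / (2 * real (m k choose (m k div 2)))) < real N"
  then have N: "real N \<le> real (m 1) +
        (real (num_chains t (m 1)) + (real (num_chains t (m 1)) - 1) * log 2 (real k - 1) - 1)
          / (4 * real (m 1 choose (m 1 div 2)))"
    "real N \<le> real (m k) +
        (real (num_chains t (m k)) - 1) / (2 * real (m k choose (m k div 2)))"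
    by (simp_all only: not_less min.bounded_iff)
  have m: "m 1 \<le> m i" if "1 \<le> i" "i \<le> k" for i using assms(4) that by blast
  have mk: "2 \<le> m k" using m[of k] assms(1-3) nondegenerate by linarith
  show False
  proof (cases "N < m k")
    case True
    then show False
      using not_ramsey_property_if_less[of k m t N] ramsey m assms(1-3) by force
  next
    case False
    show False
    proof (cases "2 \<le> m 1")
      case True
      then show False
        using not_ramsey_property_large[OF assms(1) _ assms(3) m True _ N] ramsey False assms(2)
        by linarith
    next
      case m1: False
      \<comment> \<open>One 2-chain makes the first term of the minimum at most 1, whereas
        \<open>N\<close> is at least \<open>m k\<close>, hence at least 2.\<close>
      then have "m 1 = 1" "t = 2" using assms(2,3) by auto
      then have "num_chains t (m 1) \<le> 1" using num_chains_2_1 by simp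
      moreover have "0 \<le> log 2 (real k - 1)" using assms(1) by simp
      ultimately have "real (num_chains t (m 1)) + (real (num_chains t (m 1)) - 1) * log 2 (real k - 1) - 1 \<le> 0"
        by (smt (verit) mult_nonpos_nonneg of_nat_1 of_nat_le_iff)
      then have "real N \<le> 1" using N(1) \<open>m 1 = 1\<close> by (simp add: field_simps)
      then show False using False mk by simp
    qed
  qed
qed

end
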